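(* Let $f:A\to B$ and $g:A\to C$ be ring homomorphisms, and let $J$ be an ideal of $B$ and $J'$ an ideal of $C$ such that $f^{-1}(J)=g^{-1}(J')$. Then $\operatorname{Spec}(A\bowtie^{f,g}(J,J'))$ is Noetherian if and only if both $\operatorname{Spec}(f(A)+J)$ and $\operatorname{Spec}(g(A)+J')$ are Noetherian.
   Context: All rings are commutative with unity, and ring homomorphisms are unital. The bi-amalgamation of $A$ with $(B,C)$ along $(J,J')$ with respect to $(f,g)$ is the subring of $B\times C$ $$A\bowtie^{f,g}(J,J'):=\{(f(a)+j,\,g(a)+j')\mid a\in A,\ (j,j')\in J\times J'\}.$$ Here $f(A)+J=\{f(a)+j\mid a\in A, j\in J\}$ is a subring of $B$ and $g(A)+J'$ is a subring of $C$ (defined analogously). The prime spectrum $\operatorname{Spec}(R)$ of a ring $R$ is said to be Noetherian if $R$ satisfies the ascending chain condition on radical ideals. *)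

theory Defs
  imports "HOL-Algebra.Algebra"
begin

definition ideal_radical :: "('a, 'm) ring_scheme \<Rightarrow> 'a set \<Rightarrow> 'a set"
  where "ideal_radical R I = {x \<in> carrier R. \<exists>n::nat. n > 0 \<and> x [^]\<^bsub>R\<^esub> n \<in> I}"

text \<open>The unit ideal counts as a radical ideal.\<close>

definition radical_ideal :: "'a set \<Rightarrow> ('a, 'm) ring_scheme \<Rightarrow> bool"
  where "radical_ideal I R \<longleftrightarrow> ideal I R \<and> ideal_radical R I = I"

text \<open>\<open>Spec(R)\<close> is Noetherian, by definition, when \<open>R\<close> satisfies the ascending chain
  condition on radical ideals.\<close>

definition noetherian_spectrum :: "('a, 'm) ring_scheme \<Rightarrow> bool"
  where "noetherian_spectrum R \<longleftrightarrow>
    (\<forall>I :: nat \<Rightarrow> 'a set.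
       (\<forall>n. radical_ideal (I n) R) \<and> (\<forall>n. I n \<subseteq> I (Suc n))
         \<longrightarrow> (\<exists>N. \<forall>n\<ge>N. I n = I N))"

definition image_plus_ideal ::
    "('a, 'm) ring_scheme \<Rightarrow> ('b, 'n) ring_scheme \<Rightarrow> ('a \<Rightarrow> 'b) \<Rightarrow> 'b set \<Rightarrow> ('b, 'n) ring_scheme"
  where "image_plus_ideal A B f J =
    B\<lparr>carrier := {f a \<oplus>\<^bsub>B\<^esub> j | a j. a \<in> carrier A \<and> j \<in> J}\<rparr>"

definition bi_amalgamation ::
    "('a, 'm) ring_scheme \<Rightarrow> ('b, 'n) ring_scheme \<Rightarrow> ('c, 'p) ring_scheme
      \<Rightarrow> ('a \<Rightarrow> 'b) \<Rightarrow> ('a \<Rightarrow> 'c) \<Rightarrow> 'b set \<Rightarrow> 'c set \<Rightarrow> ('b \<times> 'c) ring"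
  where "bi_amalgamation A B C f g J J' =
    (RDirProd B C)\<lparr>carrier :=
      {(f a \<oplus>\<^bsub>B\<^esub> j, g a \<oplus>\<^bsub>C\<^esub> j') | a j j'. a \<in> carrier A \<and> j \<in> J \<and> j' \<in> J'}\<rparr>"

lemma RDirProd_simps:
  "(b, c) \<oplus>\<^bsub>RDirProd B C\<^esub> (b', c') = (b \<oplus>\<^bsub>B\<^esub> b', c \<oplus>\<^bsub>C\<^esub> c')"
  "(b, c) \<otimes>\<^bsub>RDirProd B C\<^esub> (b', c') = (b \<otimes>\<^bsub>B\<^esub> b', c \<otimes>\<^bsub>C\<^esub> c')"
  "\<zero>\<^bsub>RDirProd B C\<^esub> = (\<zero>\<^bsub>B\<^esub>, \<zero>\<^bsub>C\<^esub>)"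
  "\<one>\<^bsub>RDirProd B C\<^esub> = (\<one>\<^bsub>B\<^esub>, \<one>\<^bsub>C\<^esub>)"
  by (simp_all add: RDirProd_def DirProd_def monoid.defs)

lemma RDirProd_cring:
  assumes "cring B" and "cring C"
  shows "cring (RDirProd B C)"
proof -
  interpret B: cring B by fact
  interpret C: cring C by fact
  interpret P: ring "RDirProd B C"
    by (rule RDirProd_ring) (rule B.ring_axioms, rule C.ring_axioms)
  show ?thesis
    by unfold_locales (auto simp: RDirProd_carrier RDirProd_simps B.m_comm C.m_comm)
qed

lemma image_plus_ideal_subring:
  assumes "cring A" and "cring B" and "f \<in> ring_hom A B" and "ideal J B"
  shows "subring (carrier (image_plus_ideal A B f J)) B"
proof -
  interpret A: cring A by fact
  interpret B: cring B by fact
  interpret f: ring_hom_cring A B f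
    by unfold_locales (rule assms(3))
  interpret J: ideal J B by fact
  have Jc: "j \<in> carrier B" if "j \<in> J" for j
    using that J.a_subset by blast
  have mem: "x \<in> carrier (image_plus_ideal A B f J)"
    if "x = f a \<oplus>\<^bsub>B\<^esub> j" "a \<in> carrier A" "j \<in> J" for x a j
    using that(2,3) unfolding that(1) image_plus_ideal_def by auto
  show ?thesis
  proof (rule B.subringI)
    show "carrier (image_plus_ideal A B f J) \<subseteq> carrier B"
      by (auto simp: image_plus_ideal_def Jc)
    have "\<one>\<^bsub>B\<^esub> = f \<one>\<^bsub>A\<^esub> \<oplus>\<^bsub>B\<^esub> \<zero>\<^bsub>B\<^esub>"
      by simp
    then show "\<one>\<^bsub>B\<^esub> \<in> carrier (image_plus_ideal A B f J)"
      using A.one_closed J.zero_closed by (rule mem)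
  next
    fix x assume "x \<in> carrier (image_plus_ideal A B f J)"
    then obtain a j where x: "a \<in> carrier A" "j \<in> J" "x = f a \<oplus>\<^bsub>B\<^esub> j"
      by (auto simp: image_plus_ideal_def)
    have "\<ominus>\<^bsub>B\<^esub> x = f (\<ominus>\<^bsub>A\<^esub> a) \<oplus>\<^bsub>B\<^esub> (\<ominus>\<^bsub>B\<^esub> j)"
      using x Jc by (simp add: B.minus_add)
    then show "\<ominus>\<^bsub>B\<^esub> x \<in> carrier (image_plus_ideal A B f J)"
      using A.a_inv_closed[OF x(1)] J.a_inv_closed[OF x(2)] by (rule mem)
  next
    fix x y
    assume "x \<in> carrier (image_plus_ideal A B f J)" and "y \<in> carrier (image_plus_ideal A B f J)"
    then obtain a j b k where x: "a \<in> carrier A" "j \<in> J" "x = f a \<oplus>\<^bsub>B\<^esub> j"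
      and y: "b \<in> carrier A" "k \<in> J" "y = f b \<oplus>\<^bsub>B\<^esub> k"
      by (auto simp: image_plus_ideal_def)
    have "x \<otimes>\<^bsub>B\<^esub> y = f (a \<otimes>\<^bsub>A\<^esub> b) \<oplus>\<^bsub>B\<^esub> (f a \<otimes>\<^bsub>B\<^esub> k \<oplus>\<^bsub>B\<^esub> j \<otimes>\<^bsub>B\<^esub> (f b \<oplus>\<^bsub>B\<^esub> k))"
      using x y Jc by (simp add: B.l_distr B.r_distr B.a_ac)
    moreover have "a \<otimes>\<^bsub>A\<^esub> b \<in> carrier A"
      using x y by simp
    moreover have "f a \<otimes>\<^bsub>B\<^esub> k \<oplus>\<^bsub>B\<^esub> j \<otimes>\<^bsub>B\<^esub> (f b \<oplus>\<^bsub>B\<^esub> k) \<in> J"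
      using x y Jc by (intro J.a_closed J.I_l_closed J.I_r_closed) auto
    ultimately show "x \<otimes>\<^bsub>B\<^esub> y \<in> carrier (image_plus_ideal A B f J)"
      by (rule mem)
    have "x \<oplus>\<^bsub>B\<^esub> y = f (a \<oplus>\<^bsub>A\<^esub> b) \<oplus>\<^bsub>B\<^esub> (j \<oplus>\<^bsub>B\<^esub> k)"
      using x y Jc by (simp add: B.a_ac)
    then show "x \<oplus>\<^bsub>B\<^esub> y \<in> carrier (image_plus_ideal A B f J)"
      using A.a_closed[OF x(1) y(1)] J.a_closed[OF x(2) y(2)] by (rule mem)
  qed
qed

lemma bi_amalgamation_subring:
  assumes "cring A" and "cring B" and "cring C"
    and "f \<in> ring_hom A B" and "g \<in> ring_hom A C" and "ideal J B" and "ideal J' C"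
  shows "subring (carrier (bi_amalgamation A B C f g J J')) (RDirProd B C)"
proof -
  interpret B: cring B by fact
  interpret C: cring C by fact
  interpret P: cring "RDirProd B C" by (rule RDirProd_cring) fact+
  let ?h = "\<lambda>a. (f a, g a)"
  have h: "?h \<in> ring_hom A (RDirProd B C)"
    using assms(4,5) by (auto simp: ring_hom_def RDirProd_carrier RDirProd_simps)
  interpret J: ideal J B by fact
  interpret J': ideal J' C by fact
  have sub: "J \<subseteq> carrier B" "J' \<subseteq> carrier C"
    using J.a_subset J'.a_subset by auto
  have I: "ideal (J \<times> J') (RDirProd B C)"
  proof (rule idealI[OF P.ring_axioms])
    show "subgroup (J \<times> J') (add_monoid (RDirProd B C))"
      unfolding RDirProd_add_monoid
      by (rule DirProd_subgroups)
        (use B.a_group C.a_group J.a_subgroup J'.a_subgroup in auto)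
  qed (use sub J.I_l_closed J.I_r_closed J'.I_l_closed J'.I_r_closed
       in \<open>auto simp: RDirProd_carrier RDirProd_simps\<close>)
  have "carrier (bi_amalgamation A B C f g J J')
      = carrier (image_plus_ideal A (RDirProd B C) ?h (J \<times> J'))"
    by (force simp: bi_amalgamation_def image_plus_ideal_def RDirProd_simps)
  then show ?thesis
    using image_plus_ideal_subring[OF assms(1) P.is_cring h I] by simp
qed

end

theory Submission
  imports Defs
begin

text \<open>
  Both \<open>f(A) + J\<close> and \<open>g(A) + J'\<close> are images of \<open>R = A \<bowtie> (J, J')\<close> under the two
  projections \<open>h\<close> and \<open>k\<close>, and the product of the kernels is zero.
  A surjective image of a ring with Noetherian spectrum has Noetherian spectrum, which is one
  direction. Conversely, a radical ideal \<open>I\<close> of \<open>R\<close> is recovered from the radicals of its two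
  images: if \<open>h x\<^sup>n = h i\<close> and \<open>k x\<^sup>m = k i'\<close> with \<open>i, i' \<in> I\<close>, then
  \<open>(x\<^sup>n - i) (x\<^sup>m - i') = 0\<close>, so \<open>x\<^sup>n\<^sup>+\<^sup>m \<in> I\<close> and \<open>x \<in> I\<close>. Hence an
  ascending chain of radical ideals of \<open>R\<close> is stationary once the radicals of its two images are.
\<close>

section \<open>Radicals of ideals\<close>

lemma ideal_radicalI:
  "\<lbrakk>x \<in> carrier R; (n::nat) > 0; x [^]\<^bsub>R\<^esub> n \<in> I\<rbrakk> \<Longrightarrow> x \<in> ideal_radical R I"
  by (auto simp: ideal_radical_def)

lemma ideal_radicalE:
  assumes "x \<in> ideal_radical R I"
  obtains n :: nat where "x \<in> carrier R" "n > 0" "x [^]\<^bsub>R\<^esub> n \<in> I"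
  using assms by (auto simp: ideal_radical_def)

lemma ideal_radical_mono: "I \<subseteq> K \<Longrightarrow> ideal_radical R I \<subseteq> ideal_radical R K"
  by (auto simp: ideal_radical_def)

lemma (in ring) subset_ideal_radical:
  assumes "I \<subseteq> carrier R"
  shows "I \<subseteq> ideal_radical R I"
proof
  fix x assume "x \<in> I"
  with assms show "x \<in> ideal_radical R I"
    by (intro ideal_radicalI[of _ _ 1]) auto
qed

text \<open>This takes the place of the binomial theorem in showing that radicals are closed under
  sums. Splitting one factor \<open>x \<oplus> y\<close> raises \<open>p\<close> or \<open>q\<close>
  by one and lowers \<open>r\<close> by one, so \<open>p + q + r\<close> stays fixed. The prefix of
  powers of \<open>x\<close> and \<open>y\<close> is carried along to make this induction on
  \<open>r\<close> possible. At \<open>r = 0\<close> the bound forces \<open>n \<le> p\<close> or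
  \<open>m \<le> q\<close>.\<close>

lemma (in cring) add_pow_mem_ideal:
  fixes p q r n m :: nat
  assumes I: "ideal I R" and x: "x \<in> carrier R" and y: "y \<in> carrier R"
    and xn: "x [^] n \<in> I" and ym: "y [^] m \<in> I" and le: "n + m \<le> p + q + r"
  shows "x [^] p \<otimes> y [^] q \<otimes> (x \<oplus> y) [^] r \<in> I"
  using le
proof (induction r arbitrary: p q)
  case 0
  interpret I: ideal I R by fact
  consider "n \<le> p" | "m \<le> q" using 0 by linarith
  then have "x [^] p \<otimes> y [^] q \<in> I"
  proof cases
    case 1
    then have "x [^] p = x [^] n \<otimes> x [^] (p - n)" using x by (simp add: nat_pow_mult)
    then show ?thesis using x y xn by (simp add: I.I_r_closed)
  next
    case 2
    then have "y [^] q = y [^] m \<otimes> y [^] (q - m)" using y by (simp add: nat_pow_mult)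
    then show ?thesis using x y ym by (simp add: I.I_l_closed I.I_r_closed)
  qed
  then show ?case using x y by simp
next
  case (Suc r)
  interpret I: ideal I R by fact
  have "x [^] Suc p \<otimes> y [^] q \<otimes> (x \<oplus> y) [^] r \<in> I"
    and "x [^] p \<otimes> y [^] Suc q \<otimes> (x \<oplus> y) [^] r \<in> I"
    using Suc.prems by (intro Suc.IH; simp)+
  then have "x [^] Suc p \<otimes> y [^] q \<otimes> (x \<oplus> y) [^] r \<oplus>
      x [^] p \<otimes> y [^] Suc q \<otimes> (x \<oplus> y) [^] r \<in> I"
    by (rule I.a_closed)
  also have "x [^] Suc p \<otimes> y [^] q \<otimes> (x \<oplus> y) [^] r \<oplus>
      x [^] p \<otimes> y [^] Suc q \<otimes> (x \<oplus> y) [^] r =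
      x [^] p \<otimes> y [^] q \<otimes> (x \<oplus> y) [^] r \<otimes> x \<oplus>
      x [^] p \<otimes> y [^] q \<otimes> (x \<oplus> y) [^] r \<otimes> y"
    using x y by (simp add: m_ac)
  also have "\<dots> = x [^] p \<otimes> y [^] q \<otimes> (x \<oplus> y) [^] Suc r"
    using x y by (simp add: r_distr m_assoc)
  finally show ?case .
qed

lemma (in cring) ideal_radical_is_ideal:
  assumes "ideal I R"
  shows "ideal (ideal_radical R I) R"
proof -
  interpret I: ideal I R by fact
  have mult: "x \<otimes> y \<in> ideal_radical R I"
    if "x \<in> ideal_radical R I" "y \<in> carrier R" for x y
    using that(1)
  proof (rule ideal_radicalE)
    fix n :: nat assume "x \<in> carrier R" "n > 0" "x [^] n \<in> I"
    with that(2) show ?thesis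
      by (intro ideal_radicalI[of _ _ n]) (auto simp: nat_pow_distrib I.I_r_closed)
  qed
  have closed: "x \<in> carrier R" if "x \<in> ideal_radical R I" for x
    using that by (rule ideal_radicalE)
  show ?thesis
  proof (rule idealI[OF ring_axioms])
    show "subgroup (ideal_radical R I) (add_monoid R)"
    proof (rule add.subgroupI)
      show "ideal_radical R I \<subseteq> carrier R" using closed by blast
      show "ideal_radical R I \<noteq> {}"
        using subset_ideal_radical[OF I.a_subset] I.zero_closed by blast
    next
      fix x assume x: "x \<in> ideal_radical R I"
      \<comment> \<open>Negation is multiplication by minus one, so absorption covers it.\<close>
      have "x \<otimes> (\<ominus> \<one>) \<in> ideal_radical R I" using mult[OF x] by simp
      then show "\<ominus> x \<in> ideal_radical R I" using closed[OF x] by (simp add: r_minus)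
    next
      fix x y assume "x \<in> ideal_radical R I" "y \<in> ideal_radical R I"
      then obtain n m :: nat where
        x: "x \<in> carrier R" "n > 0" "x [^] n \<in> I" and y: "y \<in> carrier R" "y [^] m \<in> I"
        by (meson ideal_radicalE)
      have "(x \<oplus> y) [^] (n + m) \<in> I"
        using add_pow_mem_ideal[OF assms x(1) y(1) x(3) y(2), of 0 0 "n + m"] x(1) y(1) by simp
      then show "x \<oplus> y \<in> ideal_radical R I"
        using x y by (intro ideal_radicalI[of _ _ "n + m"]) auto
    qed
  qed (use mult closed m_comm in auto)
qed

text \<open>Taking radicals is idempotent because iterated exponents multiply. This turns arbitrary
  ideals into members of chains to which the Noetherian condition applies.\<close>

lemma (in cring) radical_ideal_ideal_radical:
  assumes "ideal I R"
  shows "radical_ideal (ideal_radical R I) R"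
proof -
  have id: "ideal (ideal_radical R I) R" by (rule ideal_radical_is_ideal) fact
  have "ideal_radical R (ideal_radical R I) \<subseteq> ideal_radical R I"
  proof
    fix x assume "x \<in> ideal_radical R (ideal_radical R I)"
    then obtain n m :: nat where "x \<in> carrier R" "n > 0" "m > 0" "(x [^] n) [^] m \<in> I"
      by (meson ideal_radicalE)
    then show "x \<in> ideal_radical R I"
      by (intro ideal_radicalI[of _ _ "n * m"]) (auto simp: nat_pow_pow)
  qed
  moreover have "ideal_radical R I \<subseteq> ideal_radical R (ideal_radical R I)"
    using subset_ideal_radical[OF ideal.Icarr[OF id, THEN subsetI]] by blast
  ultimately show ?thesis using id by (auto simp: radical_ideal_def)
qed

lemma noetherian_spectrumD:
  assumes "noetherian_spectrum R" "\<And>n. radical_ideal (I n) R" "\<And>n. I n \<subseteq> I (Suc n)"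
  shows "\<exists>N::nat. \<forall>n\<ge>N. I n = I N"
  using assms unfolding noetherian_spectrum_def by blast

section \<open>Ideals along ring homomorphisms\<close>

lemma (in ring_hom_cring) ideal_image:
  assumes I: "ideal I R" and surj: "h ` carrier R = carrier S"
  shows "ideal (h ` I) S"
proof -
  interpret I: ideal I R by fact
  note [simp] = I.Icarr
  \<comment> \<open>Surjectivity enters here: the multiplier \<open>s\<close> lifts to
    \<open>R\<close>, where \<open>I\<close> absorbs it.\<close>
  have mult: "h i \<otimes>\<^bsub>S\<^esub> s \<in> h ` I" if i: "i \<in> I" and s: "s \<in> carrier S" for i s
  proof -
    obtain r where "r \<in> carrier R" "s = h r" using s surj by blast
    then have "h i \<otimes>\<^bsub>S\<^esub> s = h (i \<otimes> r)" and "i \<otimes> r \<in> I"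
      using i I.I_r_closed by auto
    then show ?thesis by blast
  qed
  show ?thesis
  proof (rule idealI[OF S.ring_axioms])
    show "subgroup (h ` I) (add_monoid S)"
    proof (rule S.add.subgroupI)
      show "h ` I \<subseteq> carrier S" by auto
      show "h ` I \<noteq> {}" using I.zero_closed by blast
    next
      fix a assume "a \<in> h ` I"
      then obtain i where "i \<in> I" "a = h i" by blast
      then have "\<ominus>\<^bsub>S\<^esub> a = h (\<ominus> i)" by simp
      then show "\<ominus>\<^bsub>S\<^esub> a \<in> h ` I" using I.a_inv_closed[OF \<open>i \<in> I\<close>] by blast
    next
      fix a b assume "a \<in> h ` I" "b \<in> h ` I"
      then obtain i j where "i \<in> I" "a = h i" "j \<in> I" "b = h j" by blast
      then have "a \<oplus>\<^bsub>S\<^esub> b = h (i \<oplus> j)" by simp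
      then show "a \<oplus>\<^bsub>S\<^esub> b \<in> h ` I" using I.a_closed[OF \<open>i \<in> I\<close> \<open>j \<in> I\<close>] by blast
    qed
  next
    fix a s assume a: "a \<in> h ` I" and s: "s \<in> carrier S"
    then show "a \<otimes>\<^bsub>S\<^esub> s \<in> h ` I" using mult by blast
    moreover have "a \<in> carrier S" using a by auto
    ultimately show "s \<otimes>\<^bsub>S\<^esub> a \<in> h ` I" using s S.m_comm by metis
  qed
qed

lemma (in ring_hom_cring) radical_ideal_vimage:
  assumes "radical_ideal I S"
  shows "radical_ideal {r \<in> carrier R. h r \<in> I} R"
proof -
  let ?K = "{r \<in> carrier R. h r \<in> I}"
  from assms have I: "ideal I S" and rad: "ideal_radical S I = I"
    by (auto simp: radical_ideal_def)
  have K: "ideal ?K R" using I by (rule ring.ideal_vimage)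
  have "ideal_radical R ?K \<subseteq> ?K"
  proof
    fix x assume "x \<in> ideal_radical R ?K"
    then obtain n :: nat where x: "x \<in> carrier R" "n > 0" "h (x [^] n) \<in> I"
      by (auto elim: ideal_radicalE)
    then have "h x \<in> ideal_radical S I"
      by (intro ideal_radicalI[of _ _ n]) auto
    with x rad show "x \<in> ?K" by simp
  qed
  moreover have "?K \<subseteq> ideal_radical R ?K" by (rule R.subset_ideal_radical) auto
  ultimately show ?thesis using K by (auto simp: radical_ideal_def)
qed

text \<open>A chain in \<open>S\<close> is pulled back to a chain of radical ideals in
  \<open>R\<close>, which becomes stationary. Surjectivity makes each ideal the image of its
  preimage, so stationarity passes back to \<open>S\<close>.\<close>

lemma (in ring_hom_cring) noetherian_spectrum_surj_image:
  assumes noeth: "noetherian_spectrum R" and surj: "h ` carrier R = carrier S"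
  shows "noetherian_spectrum S"
  unfolding noetherian_spectrum_def
proof (intro allI impI, elim conjE)
  fix I :: "nat \<Rightarrow> _ set"
  assume rad: "\<forall>n. radical_ideal (I n) S" and chain: "\<forall>n. I n \<subseteq> I (Suc n)"
  let ?K = "\<lambda>n. {r \<in> carrier R. h r \<in> I n}"
  have img: "h ` ?K n = I n" for n
  proof -
    have "I n \<subseteq> h ` carrier R"
      unfolding surj using rad ideal.Icarr by (fastforce simp: radical_ideal_def)
    then show ?thesis by blast
  qed
  have "radical_ideal (?K n) R" "?K n \<subseteq> ?K (Suc n)" for n
    using rad chain radical_ideal_vimage by blast+
  then have "\<exists>N. \<forall>n\<ge>N. ?K n = ?K N"
    by (rule noetherian_spectrumD[OF noeth])
  then show "\<exists>N. \<forall>n\<ge>N. I n = I N" using img by metis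
qed

section \<open>Recovering radical ideals from two images\<close>

lemma radical_ideal_eq_vimages_of_images:
  assumes h: "ring_hom_cring R S h" and k: "ring_hom_cring R T k"
    and ker: "\<And>u v. \<lbrakk>u \<in> carrier R; v \<in> carrier R; h u = \<zero>\<^bsub>S\<^esub>; k v = \<zero>\<^bsub>T\<^esub>\<rbrakk>
      \<Longrightarrow> u \<otimes>\<^bsub>R\<^esub> v = \<zero>\<^bsub>R\<^esub>"
    and I: "radical_ideal I R"
  shows "I = {x \<in> carrier R. h x \<in> ideal_radical S (h ` I) \<and> k x \<in> ideal_radical T (k ` I)}"
    (is "I = ?K")
proof
  interpret h: ring_hom_cring R S h by fact
  interpret k: ring_hom_cring R T k by fact
  interpret I: ideal I R using I by (simp add: radical_ideal_def)
  note [simp] = I.Icarr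
  have "h ` I \<subseteq> ideal_radical S (h ` I)" by (rule h.S.subset_ideal_radical) auto
  moreover have "k ` I \<subseteq> ideal_radical T (k ` I)" by (rule k.S.subset_ideal_radical) auto
  ultimately show "I \<subseteq> ?K" by auto
  show "?K \<subseteq> I"
  proof
    fix x assume "x \<in> ?K"
    then obtain n m :: nat and i i' where x: "x \<in> carrier R" and n: "n > 0"
      and i: "i \<in> I" "h x [^]\<^bsub>S\<^esub> n = h i" and i': "i' \<in> I" "k x [^]\<^bsub>T\<^esub> m = k i'"
      by (auto elim!: ideal_radicalE)
    let ?a = "x [^]\<^bsub>R\<^esub> n" and ?b = "x [^]\<^bsub>R\<^esub> m"
    \<comment> \<open>The differences \<open>u\<close> and \<open>v\<close> between the powers of
      \<open>x\<close> and the chosen elements of \<open>I\<close> lie in the kernels of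
      \<open>h\<close> and \<open>k\<close>, so \<open>ker\<close> annihilates their
      product.\<close>
    define u where "u = ?a \<oplus>\<^bsub>R\<^esub> \<ominus>\<^bsub>R\<^esub> i"
    define v where "v = ?b \<oplus>\<^bsub>R\<^esub> \<ominus>\<^bsub>R\<^esub> i'"
    have uv: "u \<in> carrier R" "v \<in> carrier R" using x i i' by (auto simp: u_def v_def)
    have a: "?a = u \<oplus>\<^bsub>R\<^esub> i" and b: "?b = v \<oplus>\<^bsub>R\<^esub> i'"
      using x i i' by (auto simp: u_def v_def h.R.a_assoc h.R.l_neg)
    have "h u = \<zero>\<^bsub>S\<^esub>" using x i by (simp add: u_def h.S.r_neg)
    moreover have "k v = \<zero>\<^bsub>T\<^esub>" using x i' by (simp add: v_def k.S.r_neg)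
    ultimately have zero: "u \<otimes>\<^bsub>R\<^esub> v = \<zero>\<^bsub>R\<^esub>" using uv ker by blast
    have "x [^]\<^bsub>R\<^esub> (n + m) = ?a \<otimes>\<^bsub>R\<^esub> ?b" using x by (simp add: h.R.nat_pow_mult)
    \<comment> \<open>Once the product of \<open>u\<close> and \<open>v\<close> vanishes, each
      remaining term has a factor \<open>i\<close> or \<open>i'\<close> from
      \<open>I\<close>.\<close>
    also have "\<dots> = u \<otimes>\<^bsub>R\<^esub> i' \<oplus>\<^bsub>R\<^esub> i \<otimes>\<^bsub>R\<^esub> (v \<oplus>\<^bsub>R\<^esub> i')"
      unfolding a b using uv i i' zero by (simp add: h.R.l_distr h.R.r_distr h.R.a_lcomm)
    also have "\<dots> \<in> I"
      using uv i i' by (intro I.a_closed I.I_l_closed I.I_r_closed) auto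
    finally have "x \<in> ideal_radical R I"
      using x n by (intro ideal_radicalI[of _ _ "n + m"]) auto
    then show "x \<in> I" using assms(4) by (simp add: radical_ideal_def)
  qed
qed

text \<open>The image of a radical ideal under a surjection is an ideal but need not be radical, so
  the chains compared in \<open>S\<close> and \<open>T\<close> consist of the radicals of the
  images.\<close>

lemma noetherian_spectrum_of_surj_images:
  fixes R :: "('a, 'm) ring_scheme" and S :: "('b, 'n) ring_scheme" and T :: "('c, 'p) ring_scheme"
  assumes h: "ring_hom_cring R S h" and hs: "h ` carrier R = carrier S"
    and k: "ring_hom_cring R T k" and ks: "k ` carrier R = carrier T"
    and ker: "\<And>u v. \<lbrakk>u \<in> carrier R; v \<in> carrier R; h u = \<zero>\<^bsub>S\<^esub>; k v = \<zero>\<^bsub>T\<^esub>\<rbrakk>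
      \<Longrightarrow> u \<otimes>\<^bsub>R\<^esub> v = \<zero>\<^bsub>R\<^esub>"
    and S: "noetherian_spectrum S" and T: "noetherian_spectrum T"
  shows "noetherian_spectrum R"
  unfolding noetherian_spectrum_def
proof (intro allI impI, elim conjE)
  fix I :: "nat \<Rightarrow> 'a set"
  assume rad: "\<forall>n. radical_ideal (I n) R" and chain: "\<forall>n. I n \<subseteq> I (Suc n)"
  interpret h: ring_hom_cring R S h by fact
  interpret k: ring_hom_cring R T k by fact
  let ?P = "\<lambda>n. ideal_radical S (h ` I n)" and ?Q = "\<lambda>n. ideal_radical T (k ` I n)"
  have I: "ideal (I n) R" for n using rad by (simp add: radical_ideal_def)
  have "radical_ideal (?P n) S" "?P n \<subseteq> ?P (Suc n)" for n
    using h.S.radical_ideal_ideal_radical[OF h.ideal_image[OF I hs]] chain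
    by (auto intro!: ideal_radical_mono image_mono)
  then have "\<exists>N. \<forall>n\<ge>N. ?P n = ?P N"
    by (rule noetherian_spectrumD[OF S])
  then obtain N where N: "\<And>n. n \<ge> N \<Longrightarrow> ?P n = ?P N" by blast
  have "radical_ideal (?Q n) T" "?Q n \<subseteq> ?Q (Suc n)" for n
    using k.S.radical_ideal_ideal_radical[OF k.ideal_image[OF I ks]] chain
    by (auto intro!: ideal_radical_mono image_mono)
  then have "\<exists>N. \<forall>n\<ge>N. ?Q n = ?Q N"
    by (rule noetherian_spectrumD[OF T])
  then obtain M where M: "\<And>n. n \<ge> M \<Longrightarrow> ?Q n = ?Q M" by blast
  \<comment> \<open>Each \<open>I n\<close> is determined by the pair \<open>?P n\<close>,
    \<open>?Q n\<close>, so the chain is constant from the index where both image chains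
    are.\<close>
  have eq: "I n = {x \<in> carrier R. h x \<in> ?P n \<and> k x \<in> ?Q n}" for n
    using radical_ideal_eq_vimages_of_images[OF h k ker] rad by blast
  have "I n = I (max N M)" if "n \<ge> max N M" for n
  proof -
    have "?P n = ?P (max N M)" "?Q n = ?Q (max N M)"
      using that N[of n] N[of "max N M"] M[of n] M[of "max N M"] by simp_all
    then show ?thesis using eq[of n] eq[of "max N M"] by simp
  qed
  then show "\<exists>N. \<forall>n\<ge>N. I n = I N" by blast
qed

section \<open>The bi-amalgamation and its two projections\<close>

theorem proposition4p4:
  fixes A :: "('a, 'm) ring_scheme" and B :: "('b, 'n) ring_scheme" and C :: "('c, 'p) ring_scheme"
    and f :: "'a \<Rightarrow> 'b" and g :: "'a \<Rightarrow> 'c" and J :: "'b set" and J' :: "'c set"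
  assumes "cring A" and "cring B" and "cring C"
    and "f \<in> ring_hom A B" and "g \<in> ring_hom A C"
    and "ideal J B" and "ideal J' C"
    and "{a \<in> carrier A. f a \<in> J} = {a \<in> carrier A. g a \<in> J'}"
  shows "noetherian_spectrum (bi_amalgamation A B C f g J J') \<longleftrightarrow>
    noetherian_spectrum (image_plus_ideal A B f J) \<and>
    noetherian_spectrum (image_plus_ideal A C g J')"
proof -
  let ?R = "bi_amalgamation A B C f g J J'"
    and ?S = "image_plus_ideal A B f J" and ?T = "image_plus_ideal A C g J'"
  interpret B: cring B by fact
  interpret C: cring C by fact
  interpret P: cring "RDirProd B C" by (rule RDirProd_cring) fact+
  interpret J: ideal J B by fact
  interpret J': ideal J' C by fact
  have subR: "subring (carrier ?R) (RDirProd B C)"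
    by (rule bi_amalgamation_subring) fact+
  have subS: "subring (carrier ?S) B" and subT: "subring (carrier ?T) C"
    by (rule image_plus_ideal_subring, fact+)+
  \<comment> \<open>In this form the three structures match \<open>subcring_iff\<close>, which turns
    the subring facts into \<open>cring\<close> facts.\<close>
  have R_eq: "?R = (RDirProd B C)\<lparr>carrier := carrier ?R\<rparr>"
    and S_eq: "?S = B\<lparr>carrier := carrier ?S\<rparr>" and T_eq: "?T = C\<lparr>carrier := carrier ?T\<rparr>"
    by (simp_all add: bi_amalgamation_def image_plus_ideal_def)
  have mem: "(f a \<oplus>\<^bsub>B\<^esub> j, g a \<oplus>\<^bsub>C\<^esub> j') \<in> carrier ?R"
    if "a \<in> carrier A" "j \<in> J" "j' \<in> J'" for a j j'
    using that by (simp add: bi_amalgamation_def) blast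
  have fst: "fst ` carrier ?R = carrier ?S"
  proof (intro equalityI subsetI)
    fix x assume "x \<in> carrier ?S"
    then obtain a j where "a \<in> carrier A" "j \<in> J" "x = f a \<oplus>\<^bsub>B\<^esub> j"
      by (auto simp: image_plus_ideal_def)
    \<comment> \<open>The lift keeps the same \<open>a\<close> and takes zero as the element of
      \<open>J'\<close>; the second projection is handled symmetrically.\<close>
    then have "(x, g a \<oplus>\<^bsub>C\<^esub> \<zero>\<^bsub>C\<^esub>) \<in> carrier ?R"
      using J'.zero_closed mem by blast
    then show "x \<in> fst ` carrier ?R" by (metis fst_conv imageI)
  qed (clarsimp simp: bi_amalgamation_def image_plus_ideal_def, blast)
  have snd: "snd ` carrier ?R = carrier ?T"
  proof (intro equalityI subsetI)
    fix x assume "x \<in> carrier ?T"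
    then obtain a j' where "a \<in> carrier A" "j' \<in> J'" "x = g a \<oplus>\<^bsub>C\<^esub> j'"
      by (auto simp: image_plus_ideal_def)
    then have "(f a \<oplus>\<^bsub>B\<^esub> \<zero>\<^bsub>B\<^esub>, x) \<in> carrier ?R"
      using J.zero_closed mem by blast
    then show "x \<in> snd ` carrier ?R" by (metis snd_conv imageI)
  qed (clarsimp simp: bi_amalgamation_def image_plus_ideal_def, blast)
  have ops: "x \<oplus>\<^bsub>?R\<^esub> y = x \<oplus>\<^bsub>RDirProd B C\<^esub> y" "x \<otimes>\<^bsub>?R\<^esub> y = x \<otimes>\<^bsub>RDirProd B C\<^esub> y"
    "\<one>\<^bsub>?R\<^esub> = \<one>\<^bsub>RDirProd B C\<^esub>" "\<zero>\<^bsub>?R\<^esub> = \<zero>\<^bsub>RDirProd B C\<^esub>" for x y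
    by (simp_all add: bi_amalgamation_def)
  have "cring ?R"
    using P.subcring_iff P.subcringI'[OF subR] subringE(1)[OF subR] R_eq by metis
  moreover have "cring ?S"
    using B.subcring_iff B.subcringI'[OF subS] subringE(1)[OF subS] S_eq by metis
  moreover have "cring ?T"
    using C.subcring_iff C.subcringI'[OF subT] subringE(1)[OF subT] T_eq by metis
  moreover have "fst \<in> ring_hom ?R ?S"
  proof -
    have "fst x \<in> carrier ?S" if "x \<in> carrier ?R" for x using that fst by blast
    moreover have "x \<oplus>\<^bsub>?S\<^esub> y = x \<oplus>\<^bsub>B\<^esub> y" "x \<otimes>\<^bsub>?S\<^esub> y = x \<otimes>\<^bsub>B\<^esub> y"
      "\<one>\<^bsub>?S\<^esub> = \<one>\<^bsub>B\<^esub>" for x y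
      by (simp_all add: image_plus_ideal_def)
    ultimately show ?thesis by (auto simp: ring_hom_def ops RDirProd_simps)
  qed
  moreover have "snd \<in> ring_hom ?R ?T"
  proof -
    have "snd x \<in> carrier ?T" if "x \<in> carrier ?R" for x using that snd by blast
    moreover have "x \<oplus>\<^bsub>?T\<^esub> y = x \<oplus>\<^bsub>C\<^esub> y" "x \<otimes>\<^bsub>?T\<^esub> y = x \<otimes>\<^bsub>C\<^esub> y"
      "\<one>\<^bsub>?T\<^esub> = \<one>\<^bsub>C\<^esub>" for x y
      by (simp_all add: image_plus_ideal_def)
    ultimately show ?thesis by (auto simp: ring_hom_def ops RDirProd_simps)
  qed
  ultimately have h: "ring_hom_cring ?R ?S fst" and k: "ring_hom_cring ?R ?T snd"
    by (simp_all add: ring_hom_cring_def ring_hom_cring_axioms_def)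
  \<comment> \<open>Here \<open>u\<close> has first component zero and \<open>v\<close> has second
    component zero, so their componentwise product vanishes.\<close>
  have ker: "u \<otimes>\<^bsub>?R\<^esub> v = \<zero>\<^bsub>?R\<^esub>"
    if "u \<in> carrier ?R" "v \<in> carrier ?R" "fst u = \<zero>\<^bsub>?S\<^esub>" "snd v = \<zero>\<^bsub>?T\<^esub>" for u v
  proof -
    have "u \<in> carrier B \<times> carrier C" "v \<in> carrier B \<times> carrier C"
      using that(1,2) subringE(1)[OF subR] by (auto simp: RDirProd_carrier)
    moreover have "fst u = \<zero>\<^bsub>B\<^esub>" "snd v = \<zero>\<^bsub>C\<^esub>"
      using that(3,4) by (simp_all add: image_plus_ideal_def)
    ultimately show ?thesis
      by (cases u, cases v) (auto simp: ops RDirProd_simps)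
  qed
  show ?thesis
    using ring_hom_cring.noetherian_spectrum_surj_image[OF h _ fst]
      ring_hom_cring.noetherian_spectrum_surj_image[OF k _ snd]
      noetherian_spectrum_of_surj_images[OF h fst k snd ker] by blast
qed

end
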